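(* For a generic $C^1$-regular convex body $K \subseteq \mathbf{R}^n$ the set $U \cap \delta_{\mathbf{R}^n \setminus K}^{-1}(r)$ fails to be a $C^1$-hypersurface whenever $U \subseteq \mathbf{R}^n$ is open and $r > 0$.
   Context: For $S \subseteq \mathbf{R}^n$, the distance function is $\delta_S(x) = \inf\{|x-a| : a \in S\}$, $x \in \mathbf{R}^n$, and $\delta_S^{-1}(r) = \{x \in \mathbf{R}^n : \delta_S(x) = r\}$. A non-empty subset $M \subseteq \mathbf{R}^n$ is a $C^1$-hypersurface if and only if for every $a \in M$ there exist an open subset $V$ of $\mathbf{R}^n$ with $a \in V$, an $(n-1)$-dimensional subspace $Z$ of $\mathbf{R}^n$, and a $C^1$-diffeomorphism $\sigma$ from $V$ onto an open subset $\sigma(V)$ of $\mathbf{R}^n$ such that $\sigma(V \cap M) = Z \cap \sigma(V)$. (The empty set is not counted as a $C^1$-hypersurface.) A convex body is a compact convex subset of $\mathbf{R}^n$ with non-empty interior; it is $C^1$-regular if its boundary is a $C^1$-hypersurface. "Generic" is understood in the sense of Baire category: the space of $C^1$-regular convex bodies in $\mathbf{R}^n$ is equipped with the Hausdorff metric, and a property holds for a generic $C^1$-regular convex body if the set of those not having the property is meagre (a countable union of nowhere dense sets) in this space.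
   Formalization: The formal statement assumes n ≥ 2; for n = 1 the claim fails, since for every interval K = [a,b] and 0 < r < (b−a)/2 the level set {a+r, b−r} is a C¹-hypersurface, and the space of such intervals is not meagre in itself. *)

theory Defs
  imports "HOL-Analysis.Analysis"
begin

definition C1_map_on :: "('a::real_normed_vector \<Rightarrow> 'b::real_normed_vector) \<Rightarrow> 'a set \<Rightarrow> bool" where
  "C1_map_on f S \<longleftrightarrow>
     (\<exists>f' :: 'a \<Rightarrow> 'a \<Rightarrow>\<^sub>L 'b.
        (\<forall>x\<in>S. (f has_derivative blinfun_apply (f' x)) (at x)) \<and> continuous_on S f')"

text \<open>Derivatives are taken in the full space, so \<open>C1_map_on\<close> is only meant for open sets; there
  it depends only on the restriction of the map, which makes \<open>inv_into\<close> a legitimate choice below.\<close>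

definition C1_diffeomorphism_onto ::
  "'a::real_normed_vector set \<Rightarrow> 'b::real_normed_vector set \<Rightarrow> ('a \<Rightarrow> 'b) \<Rightarrow> bool" where
  "C1_diffeomorphism_onto V W \<sigma> \<longleftrightarrow>
     open V \<and> open W \<and> bij_betw \<sigma> V W \<and> C1_map_on \<sigma> V \<and> C1_map_on (inv_into V \<sigma>) W"

definition C1_hypersurface :: "'a::euclidean_space set \<Rightarrow> bool" where
  "C1_hypersurface M \<longleftrightarrow>
     M \<noteq> {} \<and>
     (\<forall>a\<in>M. \<exists>(V :: 'a set) (Z :: 'a set) (\<sigma> :: 'a \<Rightarrow> 'a).
        open V \<and> a \<in> V \<and> subspace Z \<and> dim Z = DIM('a) - 1 \<and>
        C1_diffeomorphism_onto V (\<sigma> ` V) \<sigma> \<and> \<sigma> ` (V \<inter> M) = Z \<inter> \<sigma> ` V)"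

definition convex_body :: "'a::euclidean_space set \<Rightarrow> bool" where
  "convex_body K \<longleftrightarrow> compact K \<and> convex K \<and> interior K \<noteq> {}"

definition C1_regular_convex_body :: "'a::euclidean_space set \<Rightarrow> bool" where
  "C1_regular_convex_body K \<longleftrightarrow> convex_body K \<and> C1_hypersurface (frontier K)"

text \<open>The Hausdorff distance. For non-empty bounded sets the first case always applies; the value
  \<open>0\<close> otherwise makes the function total, non-negative and symmetric, as the locale
  \<open>Metric_space\<close> requires outside the carrier too.\<close>

definition hausdist :: "'a::metric_space set \<Rightarrow> 'a set \<Rightarrow> real" where
  "hausdist S T =
     (let D = (\<lambda>x. infdist x T) ` S \<union> (\<lambda>y. infdist y S) ` T
      in if D \<noteq> {} \<and> bdd_above D then Sup D else 0)"

definition C1_regular_convex_body_space :: "'a::euclidean_space set topology" where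
  "C1_regular_convex_body_space = Metric_space.mtopology {K. C1_regular_convex_body K} hausdist"

definition nowhere_dense_in :: "'a topology \<Rightarrow> 'a set \<Rightarrow> bool" where
  "nowhere_dense_in X S \<longleftrightarrow> S \<subseteq> topspace X \<and> X interior_of (X closure_of S) = {}"

definition meagre_in :: "'a topology \<Rightarrow> 'a set \<Rightarrow> bool" where
  "meagre_in X S \<longleftrightarrow> (\<exists>\<F>. countable \<F> \<and> (\<forall>T\<in>\<F>. nowhere_dense_in X T) \<and> S = \<Union>\<F>)"

definition generic_C1_regular_convex_body :: "('a::euclidean_space set \<Rightarrow> bool) \<Rightarrow> bool" where
  "generic_C1_regular_convex_body P \<longleftrightarrow>
     meagre_in C1_regular_convex_body_space {K. C1_regular_convex_body K \<and> \<not> P K}"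

lemma bdd_above_infdist_image:
  fixes S T :: "'a::metric_space set"
  assumes "bounded S" "T \<noteq> {}"
  shows "bdd_above ((\<lambda>x. infdist x T) ` S)"
proof -
  obtain t where t: "t \<in> T" using assms by auto
  obtain e where e: "\<forall>y\<in>S. dist t y \<le> e" using assms(1) bounded_any_center by blast
  have "infdist x T \<le> e" if "x \<in> S" for x
    using e that infdist_le[OF t, of x] by (force simp: dist_commute)
  then show ?thesis by (auto intro!: bdd_aboveI)
qed

lemma hausdist_eq_Sup:
  assumes "bounded S" "bounded T" "S \<noteq> {}" "T \<noteq> {}"
  shows "hausdist S T = Sup ((\<lambda>x. infdist x T) ` S \<union> (\<lambda>y. infdist y S) ` T)"
  using assms by (auto simp: hausdist_def Let_def bdd_above_infdist_image)

lemma hausdist_le_iff: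
  assumes "bounded S" "bounded T" "S \<noteq> {}" "T \<noteq> {}"
  shows "hausdist S T \<le> e \<longleftrightarrow> (\<forall>x\<in>S. infdist x T \<le> e) \<and> (\<forall>y\<in>T. infdist y S \<le> e)"
  unfolding hausdist_eq_Sup[OF assms]
  using assms by (subst cSup_le_iff) (auto simp: bdd_above_infdist_image)

lemma hausdist_nonneg: "0 \<le> hausdist S T"
proof -
  define D where "D = (\<lambda>x. infdist x T) ` S \<union> (\<lambda>y. infdist y S) ` T"
  have "0 \<le> Sup D" if "D \<noteq> {}" "bdd_above D"
  proof -
    obtain d where d: "d \<in> D" using \<open>D \<noteq> {}\<close> by blast
    then have "0 \<le> d" by (auto simp: D_def infdist_nonneg)
    also have "d \<le> Sup D" using d \<open>bdd_above D\<close> by (rule cSup_upper)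
    finally show ?thesis .
  qed
  then show ?thesis by (auto simp: hausdist_def Let_def D_def)
qed

lemma hausdist_commute: "hausdist S T = hausdist T S"
  by (simp add: hausdist_def Let_def Un_commute)

lemma infdist_le_hausdist:
  assumes "bounded S" "bounded T" "S \<noteq> {}" "T \<noteq> {}" "x \<in> S"
  shows "infdist x T \<le> hausdist S T"
  using hausdist_le_iff[OF assms(1-4), of "hausdist S T"] assms(5) by auto

lemma infdist_le_infdist_hausdist:
  assumes "bounded S" "bounded T" "S \<noteq> {}" "T \<noteq> {}"
  shows "infdist x T \<le> infdist x S + hausdist S T"
proof -
  have "infdist x T - hausdist S T \<le> dist x s" if "s \<in> S" for s
    using infdist_triangle[of x T s] infdist_le_hausdist[OF assms that] by linarith
  then have "infdist x T - hausdist S T \<le> infdist x S"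
    using assms(3) by (simp add: infdist_notempty cINF_greatest)
  then show ?thesis by linarith
qed

lemma hausdist_triangle:
  assumes "bounded S" "bounded T" "bounded U" "S \<noteq> {}" "T \<noteq> {}" "U \<noteq> {}"
  shows "hausdist S U \<le> hausdist S T + hausdist T U"
proof -
  have "infdist x U \<le> hausdist S T + hausdist T U" if "x \<in> S" for x
    using infdist_le_infdist_hausdist[of T U x] infdist_le_hausdist[of S T x] assms that by linarith
  moreover have "infdist y S \<le> hausdist S T + hausdist T U" if "y \<in> U" for y
    using infdist_le_infdist_hausdist[of T S y] infdist_le_hausdist[of U T y] assms that
      hausdist_commute[of S T] hausdist_commute[of T U] by linarith
  ultimately show ?thesis using assms by (simp add: hausdist_le_iff)
qed

lemma hausdist_eq_0_iff:
  assumes "compact S" "compact T" "S \<noteq> {}" "T \<noteq> {}"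
  shows "hausdist S T = 0 \<longleftrightarrow> S = T"
proof
  have b: "bounded S" "bounded T" and c: "closed S" "closed T"
    using assms by (auto intro: compact_imp_bounded compact_imp_closed)
  show "S = T" if "hausdist S T = 0"
  proof -
    have "infdist x T = 0" if "x \<in> S" for x
      using infdist_le_hausdist[OF b assms(3,4) that] \<open>hausdist S T = 0\<close> infdist_nonneg[of x T]
      by linarith
    moreover have "infdist y S = 0" if "y \<in> T" for y
      using infdist_le_hausdist[OF b(2,1) assms(4,3) that] \<open>hausdist S T = 0\<close> infdist_nonneg[of y S]
        hausdist_commute[of S T] by linarith
    ultimately show "S = T"
      using in_closed_iff_infdist_zero[OF c(1) assms(3)] in_closed_iff_infdist_zero[OF c(2) assms(4)]
      by blast
  qed
  show "hausdist S T = 0" if "S = T"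
    using hausdist_le_iff[OF b assms(3,4), of 0] hausdist_nonneg[of S T] that by fastforce
qed

lemma C1_regular_convex_body_compact: "C1_regular_convex_body K \<Longrightarrow> compact K"
  and C1_regular_convex_body_nonempty: "C1_regular_convex_body K \<Longrightarrow> K \<noteq> {}"
  by (auto simp: C1_regular_convex_body_def convex_body_def)

lemma Metric_space_C1_regular_convex_body:
  "Metric_space {K :: 'a::euclidean_space set. C1_regular_convex_body K} hausdist"
proof
  fix S T U :: "'a set"
  show "0 \<le> hausdist S T" by (rule hausdist_nonneg)
  show "hausdist S T = hausdist T S" by (rule hausdist_commute)
  assume S: "S \<in> {K. C1_regular_convex_body K}" and T: "T \<in> {K. C1_regular_convex_body K}"
  then show "hausdist S T = 0 \<longleftrightarrow> S = T"
    by (simp add: hausdist_eq_0_iff C1_regular_convex_body_compact C1_regular_convex_body_nonempty)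
  assume U: "U \<in> {K. C1_regular_convex_body K}"
  show "hausdist S U \<le> hausdist S T + hausdist T U"
    using S T U by (simp add: hausdist_triangle compact_imp_bounded C1_regular_convex_body_compact
        C1_regular_convex_body_nonempty)
qed

lemma topspace_C1_regular_convex_body_space:
  "topspace C1_regular_convex_body_space = {K. C1_regular_convex_body K}"
  by (simp add: C1_regular_convex_body_space_def
      Metric_space.topspace_mtopology[OF Metric_space_C1_regular_convex_body])

end

theory Submission
  imports Defs
begin

text \<open>Suppose a piece \<open>M\<close> of the level set of the distance to the complement of \<open>K\<close> at
  height \<open>r\<close> is a \<open>C\<^sup>1\<close>-hypersurface. The body \<open>C\<close> of centres of \<open>r\<close>-balls contained in \<open>K\<close> is
  convex and contains \<open>M\<close>, so its normals at a point of \<open>M\<close> lie on one line. Take a boundary point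
  \<open>z\<close> of \<open>K\<close> whose nearest point \<open>x\<close> in \<open>C\<close> belongs to \<open>M\<close>: if \<open>y\<close> is a boundary point of \<open>K\<close>
  nearest to \<open>x\<close>, then \<open>y\<close> and \<open>z\<close> are on the normal line at \<open>x\<close>, and if they are on the same
  side, they coincide and an \<open>r\<close>-ball inside \<open>K\<close> touches the boundary at \<open>z\<close>. Letting \<open>z\<close> vary
  excludes the opposite side, so the points without a touching inner \<open>r\<close>-ball are not dense in the
  boundary.

  On the other hand, for a generic \<open>K\<close> those points are dense for every \<open>r\<close>: having touching inner
  \<open>r\<close>-balls throughout an open set is a closed condition, and it is destroyed by adding to \<open>K\<close> a
  small spike, rounded off with a radius less than \<open>r\<close>.\<close>

subsection \<open>Regular level sets and parallel bodies\<close>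

text \<open>The chart \<open>\<sigma>\<close> alters only the component of \<open>x - a\<close>
  along \<open>e = n a\<close>, in such a way that \<open>e \<bullet> \<sigma> x = g x - c\<close>;
  this flattens the level set into the hyperplane \<open>Z\<close>. The derivative of
  \<open>\<sigma>\<close> at \<open>a\<close> is the identity, so the inverse function theorem
  applies.\<close>

lemma C1_hypersurface_level_set:
  fixes g :: "'a::euclidean_space \<Rightarrow> real"
  assumes "open S"
    and der: "\<And>x. x \<in> S \<Longrightarrow> (g has_derivative (\<lambda>h. n x \<bullet> h)) (at x)"
    and cont: "continuous_on S n"
    and nz: "\<And>x. x \<in> S \<Longrightarrow> n x \<noteq> 0"
    and ne: "S \<inter> {x. g x = c} \<noteq> {}"
  shows "C1_hypersurface (S \<inter> {x. g x = c})"
  unfolding C1_hypersurface_def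
proof (intro conjI ballI)
  fix a assume a: "a \<in> S \<inter> {x. g x = c}"
  define e where "e = n a"
  have e: "e \<noteq> 0" using nz a by (auto simp: e_def)
  define Z where "Z = {z. e \<bullet> z = 0}"
  define \<sigma> where "\<sigma> = (\<lambda>x. x - a + ((g x - c - e \<bullet> (x - a)) / (e \<bullet> e)) *\<^sub>R e)"
  define A where "A = (\<lambda>m::'a. id_blinfun + (blinfun_scaleR_left e o\<^sub>L blinfun_inner_left ((1 / (e \<bullet> e)) *\<^sub>R (m - e))))"
  \<comment> \<open>\<open>A (n x)\<close> is the derivative of \<open>\<sigma>\<close> at \<open>x\<close>, and \<open>B (n x)\<close> its inverse, in closed form.\<close>
  define B where "B = (\<lambda>m::'a. id_blinfun + (blinfun_scaleR_left e o\<^sub>L blinfun_inner_left ((1 / (m \<bullet> e)) *\<^sub>R (e - m))))"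
  have A_app: "blinfun_apply (A m) h = h + (((m - e) \<bullet> h) / (e \<bullet> e)) *\<^sub>R e" for m h
    by (simp add: A_def blinfun.bilinear_simps inner_commute)
  have B_app: "blinfun_apply (B m) h = h + (((e - m) \<bullet> h) / (m \<bullet> e)) *\<^sub>R e" for m h
    by (simp add: B_def blinfun.bilinear_simps inner_commute)
  have BA: "B m o\<^sub>L A m = id_blinfun" if "m \<bullet> e \<noteq> 0" for m
    using that e
    by (intro blinfun_eqI)
      (simp add: A_app B_app inner_simps divide_simps flip: scaleR_add_left, simp add: algebra_simps)
  have AB: "A m o\<^sub>L B m = id_blinfun" if "m \<bullet> e \<noteq> 0" for m
    using that e
    by (intro blinfun_eqI)
      (simp add: A_app B_app inner_simps divide_simps flip: scaleR_add_left, simp add: algebra_simps)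
  \<comment> \<open>\<open>A m\<close> is a rank-one perturbation of the identity with determinant
    \<open>(m \<bullet> e) / (e \<bullet> e)\<close>, so \<open>S'\<close> is the set where the
    derivative of \<open>\<sigma>\<close> is invertible.\<close>
  define S' where "S' = {x \<in> S. n x \<bullet> e \<noteq> 0}"
  have "open S'"
  proof -
    have "continuous_on S (\<lambda>x. n x \<bullet> e)" by (intro continuous_intros cont)
    from continuous_open_preimage[OF this \<open>open S\<close>, of "- {0}"]
    have "open (S \<inter> (\<lambda>x. n x \<bullet> e) -` (- {0}))" by auto
    moreover have "S \<inter> (\<lambda>x. n x \<bullet> e) -` (- {0}) = S'" by (auto simp: S'_def)
    ultimately show ?thesis by simp
  qed
  have aS': "a \<in> S'" using a e by (auto simp: S'_def e_def)
  have der\<sigma>: "(\<sigma> has_derivative blinfun_apply (A (n x))) (at x)" if "x \<in> S" for x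
    unfolding \<sigma>_def
    by (rule derivative_eq_intros der[OF that] refl)+
      (use e in \<open>auto simp: A_app inner_simps divide_simps fun_eq_iff\<close>)
  have contA: "continuous_on S' (\<lambda>x. A (n x))"
    unfolding A_def
    by (intro continuous_intros continuous_on_subset[OF cont]) (auto simp: S'_def e)
  have derS': "\<And>x. x \<in> S' \<Longrightarrow> (\<sigma> has_derivative blinfun_apply (A (n x))) (at x)"
    using der\<sigma> by (auto simp: S'_def)
  have na: "n a \<bullet> e \<noteq> 0" using aS' by (auto simp: S'_def)
  obtain U' V g1 g' where U': "open U'" "U' \<subseteq> S'" "a \<in> U'" and V: "open V" "\<sigma> a \<in> V"
    and hom: "homeomorphism U' V \<sigma> g1"
    and derg: "\<And>y. y \<in> V \<Longrightarrow> (g1 has_derivative (g' y)) (at y)"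
    and g': "\<And>y. y \<in> V \<Longrightarrow> g' y = inv (blinfun_apply (A (n (g1 y))))"
    by (rule inverse_function_theorem[OF \<open>open S'\<close> derS' contA aS' BA[OF na]], assumption, rule that)
  have img: "\<sigma> ` U' = V" using hom by (simp add: homeomorphism_def)
  have g1_in: "g1 y \<in> U'" if "y \<in> V" for y using hom that by (auto simp: homeomorphism_def)
  have bij: "bij_betw \<sigma> U' V"
    using hom by (intro bij_betwI[where g = g1]) (auto simp: homeomorphism_def)
  have inv_eq: "inv_into U' \<sigma> y = g1 y" if "y \<in> V" for y
    using hom that g1_in bij unfolding homeomorphism_def
    by (metis bij_betw_imp_inj_on inv_into_f_f)
  \<comment> \<open>The inverse function theorem gives the derivative of the inverse as
    \<open>inv\<close> of a function; identifying it with \<open>B\<close> turns its continuity into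
    that of a composition.\<close>
  have C1inv: "C1_map_on (inv_into U' \<sigma>) V"
    unfolding C1_map_on_def
  proof (intro exI conjI ballI)
    fix y assume y: "y \<in> V"
    have m: "n (g1 y) \<bullet> e \<noteq> 0" using g1_in[OF y] U' by (auto simp: S'_def)
    have "blinfun_apply (A (n (g1 y))) \<circ> blinfun_apply (B (n (g1 y))) = id"
      "blinfun_apply (B (n (g1 y))) \<circ> blinfun_apply (A (n (g1 y))) = id"
      using AB[OF m] BA[OF m] 
      by (auto simp: fun_eq_iff simp flip: blinfun_apply_blinfun_compose)
    then have "inv (blinfun_apply (A (n (g1 y)))) = blinfun_apply (B (n (g1 y)))"
      by (metis inv_unique_comp)
    then have "(g1 has_derivative blinfun_apply (B (n (g1 y)))) (at y)"
      using derg[OF y] g'[OF y] by simp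
    then show "(inv_into U' \<sigma> has_derivative blinfun_apply (B (n (g1 y)))) (at y)"
      by (rule has_derivative_transform_within_open[OF _ V(1) y]) (simp add: inv_eq)
  next
    have "continuous_on V g1" using hom by (simp add: homeomorphism_def)
    then have "continuous_on V (\<lambda>y. n (g1 y))"
      by (rule continuous_on_compose2[OF cont]) (use g1_in U' in \<open>auto simp: S'_def\<close>)
    then show "continuous_on V (\<lambda>y. B (n (g1 y)))"
      unfolding B_def
      by (intro continuous_intros) (use g1_in U' in \<open>auto simp: S'_def\<close>)
  qed
  have C1: "C1_map_on \<sigma> U'"
    unfolding C1_map_on_def
    using U' der\<sigma> continuous_on_subset[OF contA U'(2)] by (auto simp: S'_def intro!: exI[of _ "\<lambda>x. A (n x)"])
  have e\<sigma>: "e \<bullet> \<sigma> x = g x - c" for x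
    using e by (simp add: \<sigma>_def inner_simps)
  show "\<exists>V Z (\<sigma> :: 'a \<Rightarrow> 'a). open V \<and> a \<in> V \<and> subspace Z \<and> dim Z = DIM('a) - 1 \<and>
        C1_diffeomorphism_onto V (\<sigma> ` V) \<sigma> \<and> \<sigma> ` (V \<inter> (S \<inter> {x. g x = c})) = Z \<inter> \<sigma> ` V"
  proof (intro exI conjI)
    show "open U'" "a \<in> U'" using U' by auto
    show "subspace Z" by (simp add: Z_def subspace_hyperplane)
    show "dim Z = DIM('a) - 1" using e by (simp add: Z_def dim_hyperplane)
    show "C1_diffeomorphism_onto U' (\<sigma> ` U') \<sigma>"
      unfolding C1_diffeomorphism_onto_def img using U' V bij C1 C1inv by simp
    show "\<sigma> ` (U' \<inter> (S \<inter> {x. g x = c})) = Z \<inter> \<sigma> ` U'"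
      using U'(2) by (auto simp: Z_def e\<sigma> S'_def)
  qed
qed (use ne in auto)

lemma infdist_eq_closest_point:
  assumes "closed L" "L \<noteq> {}"
  shows "infdist x L = norm (x - closest_point L x)"
  using setdist_closest_point[OF assms, of x] by (simp add: infdist_eq_setdist dist_norm)

lemma closest_point_neq:
  assumes "closed L" "L \<noteq> {}" "x \<notin> L"
  shows "x \<noteq> closest_point L x"
  using closest_point_in_set[OF assms(1,2), of x] assms(3) by auto

text \<open>Outside a non-empty closed convex \<open>L\<close> this is the gradient of the distance
  to \<open>L\<close>; on such an \<open>L\<close> it is 0, because
  \<open>sgn 0 = 0\<close>.\<close>

definition infdist_grad :: "'a::euclidean_space set \<Rightarrow> 'a \<Rightarrow> 'a" where
  "infdist_grad L x = sgn (x - closest_point L x)"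

lemma infdist_ge_halfspace:
  fixes L :: "'a::euclidean_space set"
  assumes "\<And>l. l \<in> L \<Longrightarrow> \<nu> \<bullet> l \<le> b" "norm \<nu> = 1" "L \<noteq> {}"
  shows "\<nu> \<bullet> y - b \<le> infdist y L"
proof -
  have "\<nu> \<bullet> y - b \<le> dist y l" if "l \<in> L" for l
    using norm_cauchy_schwarz[of \<nu> "y - l"] assms(1)[OF that] assms(2)
    by (simp add: dist_norm inner_diff_right)
  then show ?thesis using assms(3) by (simp add: infdist_notempty cINF_greatest)
qed

text \<open>The half-space supporting \<open>L\<close> at the nearest point of \<open>x\<close>
  contains \<open>L\<close>, and the signed distance to it is the affine function on the
  left.\<close>

lemma infdist_grad_le:
  fixes L :: "'a::euclidean_space set"
  assumes "convex L" "closed L" "x \<notin> L" "L \<noteq> {}"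
  shows "infdist x L + infdist_grad L x \<bullet> (y - x) \<le> infdist y L"
proof -
  let ?p = "closest_point L x" and ?n = "infdist_grad L x"
  have ne: "x - ?p \<noteq> 0" using closest_point_neq assms by auto
  then have n1: "norm ?n = 1" by (simp add: infdist_grad_def norm_sgn)
  have "?n \<bullet> l \<le> ?n \<bullet> ?p" if "l \<in> L" for l
  proof -
    have "?n \<bullet> (l - ?p) = inverse (norm (x - ?p)) * ((x - ?p) \<bullet> (l - ?p))"
      by (simp add: infdist_grad_def sgn_div_norm)
    also have "\<dots> \<le> 0"
      using closest_point_dot[OF assms(1,2) that, of x] by (intro mult_nonneg_nonpos) auto
    finally show ?thesis by (simp add: inner_diff_right)
  qed
  from infdist_ge_halfspace[OF this n1 assms(4)]
  have "?n \<bullet> y - ?n \<bullet> ?p \<le> infdist y L" .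
  moreover have "?n \<bullet> (x - ?p) = infdist x L"
    using ne by (simp add: infdist_grad_def sgn_div_norm infdist_eq_closest_point assms
        flip: power2_norm_eq_inner) (simp add: power2_eq_square)
  ultimately show ?thesis by (simp add: inner_diff_right)
qed

text \<open>A squeeze: near \<open>x\<close> the distance to \<open>L\<close> lies between the
  affine minorant of \<open>infdist_grad_le\<close> and the distance to the fixed point
  \<open>closest_point L x\<close>. Both bounds agree at \<open>x\<close> and have the same gradient
  there.\<close>

lemma has_derivative_infdist_convex:
  fixes L :: "'a::euclidean_space set"
  assumes "convex L" "closed L" "L \<noteq> {}" "x \<notin> L"
  shows "((\<lambda>y. infdist y L) has_derivative (\<lambda>h. infdist_grad L x \<bullet> h)) (at x)"
proof -
  let ?p = "closest_point L x" and ?n = "infdist_grad L x"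
  have ne: "x - ?p \<noteq> 0" using closest_point_neq assms by auto
  have "((\<lambda>y. norm (y - ?p)) has_derivative (\<lambda>h. h \<bullet> ?n)) (at x)"
    unfolding infdist_grad_def
    by (rule has_derivative_compose[of "\<lambda>y. y - ?p" "\<lambda>h. h" x UNIV, OF _ has_derivative_norm[OF ne]])
      (auto intro!: derivative_eq_intros)
  then have nd: "((\<lambda>y. norm (y - ?p)) has_derivative (\<lambda>h. ?n \<bullet> h)) (at x)"
    by (simp add: inner_commute)
  show ?thesis
    unfolding has_derivative_at_within
  proof
    show "bounded_linear (\<lambda>h. ?n \<bullet> h)" by (rule bounded_linear_inner_right)
    have "((\<lambda>y. (norm (y - ?p) - norm (x - ?p) - ?n \<bullet> (y - x)) /\<^sub>R norm (y - x)) \<longlongrightarrow> 0) (at x)"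
      using nd by (simp add: has_derivative_at_within)
    moreover have "norm ((infdist y L - infdist x L - ?n \<bullet> (y - x)) /\<^sub>R norm (y - x))
      \<le> norm ((norm (y - ?p) - norm (x - ?p) - ?n \<bullet> (y - x)) /\<^sub>R norm (y - x))" for y
    proof -
      have "infdist y L \<le> norm (y - ?p)"
        using infdist_le[OF closest_point_in_set[OF assms(2,3)]] by (simp add: dist_norm)
      with infdist_grad_le[OF assms(1,2,4,3), of y] infdist_eq_closest_point[OF assms(2,3), of x]
      have "\<bar>infdist y L - infdist x L - ?n \<bullet> (y - x)\<bar> \<le> \<bar>norm (y - ?p) - norm (x - ?p) - ?n \<bullet> (y - x)\<bar>"
        by linarith
      then show ?thesis by (simp add: abs_mult mult_left_mono)
    qed
    ultimately show "((\<lambda>y. (infdist y L - infdist x L - ?n \<bullet> (y - x)) /\<^sub>R norm (y - x)) \<longlongrightarrow> 0) (at x)"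
      by (rule Lim_null_comparison[OF always_eventually[OF allI] tendsto_norm_zero, rotated])
  qed
qed

text \<open>From a point at distance exactly \<open>\<rho>\<close>, a step along the gradient
  increases the distance to \<open>L\<close>, so such a point is not interior. The intersection with
  \<open>- L\<close> gives the form that \<open>C1_hypersurface_level_set\<close> expects.\<close>

lemma frontier_parallel_body:
  fixes L :: "'a::euclidean_space set"
  assumes "convex L" "closed L" "L \<noteq> {}" "0 < \<rho>"
  shows "frontier {x. infdist x L \<le> \<rho>} = - L \<inter> {x. infdist x L = \<rho>}"
proof -
  have "closed {x. infdist x L \<le> \<rho>}"
    by (intro closed_Collect_le continuous_intros)
  moreover have "x \<in> interior {x. infdist x L \<le> \<rho>} \<longleftrightarrow> infdist x L < \<rho>" for x
  proof
    have "open {x. infdist x L < \<rho>}" by (intro open_Collect_less continuous_intros)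
    then have "{x. infdist x L < \<rho>} \<subseteq> interior {x. infdist x L \<le> \<rho>}"
      by (intro interior_maximal) auto
    then show "x \<in> interior {x. infdist x L \<le> \<rho>}" if "infdist x L < \<rho>" using that by auto
  next
    assume x: "x \<in> interior {x. infdist x L \<le> \<rho>}"
    show "infdist x L < \<rho>"
    proof (rule ccontr)
      assume "\<not> ?thesis"
      then have eq: "infdist x L = \<rho>" using x interior_subset by force
      then have "x \<notin> L" using assms by auto
      let ?n = "infdist_grad L x"
      obtain d where d: "d > 0" "cball x d \<subseteq> {x. infdist x L \<le> \<rho>}"
        using x by (meson mem_interior_cball)
      have "x \<noteq> closest_point L x" using closest_point_neq[OF assms(2,3) \<open>x \<notin> L\<close>] .
      then have n1: "norm ?n = 1" by (simp add: infdist_grad_def norm_sgn)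
      then have "x + d *\<^sub>R ?n \<in> cball x d" using d by (simp add: dist_norm)
      then have "infdist (x + d *\<^sub>R ?n) L \<le> \<rho>" using d by auto
      moreover have "?n \<bullet> ?n = 1" using n1 by (simp flip: power2_norm_eq_inner)
      ultimately show False
        using infdist_grad_le[OF assms(1,2) \<open>x \<notin> L\<close> assms(3), of "x + d *\<^sub>R ?n"] eq d by simp
    qed
  qed
  ultimately have "frontier {x. infdist x L \<le> \<rho>} = {x. infdist x L = \<rho>}"
    unfolding frontier_def by (simp add: set_eq_iff) linarith
  moreover have "x \<notin> L" if "infdist x L = \<rho>" for x
    using that assms(4) by auto
  ultimately show ?thesis by blast
qed

text \<open>The Minkowski sum of \<open>L\<close> and a ball, written with nested unions to fit
  \<open>convex_sums\<close>; it yields convexity and splits points of the parallel body.\<close>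

lemma parallel_body_eq:
  fixes L :: "'a::euclidean_space set"
  assumes "compact L" "L \<noteq> {}"
  shows "{x. infdist x L \<le> \<rho>} = (\<Union>l\<in>L. \<Union>u\<in>cball 0 \<rho>. {l + u})"
proof (intro equalityI subsetI)
  fix x assume "x \<in> {x. infdist x L \<le> \<rho>}"
  then have "x - closest_point L x \<in> cball 0 \<rho>"
    using assms by (simp add: infdist_eq_closest_point compact_imp_closed)
  moreover have "closest_point L x \<in> L"
    using assms by (simp add: closest_point_in_set compact_imp_closed)
  moreover have "x \<in> {closest_point L x + (x - closest_point L x)}" by simp
  ultimately show "x \<in> (\<Union>l\<in>L. \<Union>u\<in>cball 0 \<rho>. {l + u})"
    by blast
next
  fix x assume "x \<in> (\<Union>l\<in>L. \<Union>u\<in>cball 0 \<rho>. {l + u})"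
  then show "x \<in> {x. infdist x L \<le> \<rho>}"
    by (auto intro!: infdist_le2 simp: dist_norm)
qed

lemma convex_parallel_body:
  fixes L :: "'a::euclidean_space set"
  assumes "compact L" "convex L" "L \<noteq> {}"
  shows "convex {x. infdist x L \<le> \<rho>}"
  unfolding parallel_body_eq[OF assms(1,3)]
  by (intro convex_sums assms convex_cball)

lemma C1_regular_parallel_body:
  fixes L :: "'a::euclidean_space set"
  assumes "compact L" "convex L" "L \<noteq> {}" "0 < \<rho>"
  shows "C1_regular_convex_body {x. infdist x L \<le> \<rho>}" (is "C1_regular_convex_body ?K")
proof -
  have cl: "closed L" using assms by (simp add: compact_imp_closed)
  have cpt: "compact ?K" using assms by (intro compact_infdist_le)
  obtain l where "l \<in> L" using assms by auto
  then have "cball l \<rho> \<subseteq> ?K" by (auto intro!: infdist_le2 simp: dist_commute)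
  then have "l \<in> interior ?K" using assms by (auto simp: mem_interior_cball)
  then have int: "interior ?K \<noteq> {}" by auto
  \<comment> \<open>A hypersurface must be non-empty: a set without boundary would be empty or the
    whole space, which is unbounded.\<close>
  have "frontier ?K \<noteq> {}"
    using int compact_imp_bounded[OF cpt] not_bounded_UNIV interior_empty
    by (metis frontier_eq_empty)
  then have "C1_hypersurface (- L \<inter> {x. infdist x L = \<rho>})"
    unfolding frontier_parallel_body[OF assms(2) cl assms(3,4)]
  proof (intro C1_hypersurface_level_set[where n = "infdist_grad L"])
    show "continuous_on (- L) (infdist_grad L)"
      unfolding infdist_grad_def
      using assms cl closest_point_neq[OF cl assms(3)]
      by (intro continuous_intros continuous_on_closest_point) auto
    show "infdist_grad L x \<noteq> 0" if "x \<in> - L" for x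
      using closest_point_neq[OF cl assms(3), of x] that by (auto simp: infdist_grad_def sgn_zero_iff)
  qed (use assms cl has_derivative_infdist_convex[OF assms(2) cl assms(3)] in auto)
  then show ?thesis
    unfolding C1_regular_convex_body_def convex_body_def
    using cpt int convex_parallel_body[OF assms(1-3)] frontier_parallel_body[OF assms(2) cl assms(3,4)]
    by simp
qed

subsection \<open>Touching inner balls\<close>

definition inner_ball_at :: "'a::metric_space set \<Rightarrow> real \<Rightarrow> 'a \<Rightarrow> bool" where
  "inner_ball_at K r z \<longleftrightarrow> (\<exists>c. cball c r \<subseteq> K \<and> dist c z = r)"

text \<open>Shrink the ball by the homothety with centre \<open>z\<close> and ratio
  \<open>r / R\<close>. This allows the category argument to use only countably many radii.\<close>

lemma inner_ball_at_mono:
  fixes z :: "'a::euclidean_space"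
  assumes "inner_ball_at K R z" "0 < r" "r \<le> R"
  shows "inner_ball_at K r z"
proof -
  obtain c where c: "cball c R \<subseteq> K" "dist c z = R"
    using assms by (auto simp: inner_ball_at_def)
  define d where "d = z + (r / R) *\<^sub>R (c - z)"
  have "dist d z = r" using assms c by (simp add: d_def dist_norm)
  moreover have "dist c d = R - r"
  proof -
    have "c - d = (1 - r / R) *\<^sub>R (c - z)" by (simp add: d_def algebra_simps)
    then have "dist c d = (1 - r / R) * R"
      using assms c by (simp add: dist_norm)
    also have "\<dots> = R - r" using assms by (simp add: left_diff_distrib)
    finally show ?thesis .
  qed
  then have "cball d r \<subseteq> cball c R" by (simp add: cball_subset_cball_iff dist_commute)
  ultimately show ?thesis using c by (auto simp: inner_ball_at_def)
qed

lemma convex_body_outer_normal: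
  fixes K :: "'a::euclidean_space set"
  assumes "convex_body K" "z \<in> frontier K"
  obtains \<nu> where "norm \<nu> = 1" "\<And>k. k \<in> K \<Longrightarrow> \<nu> \<bullet> k \<le> \<nu> \<bullet> z"
proof -
  have K: "closed K" "convex K" "rel_interior K = interior K"
    using assms by (auto simp: convex_body_def compact_imp_closed rel_interior_nonempty_interior)
  then have "z \<in> K" "z \<notin> rel_interior K" using assms by (auto simp: frontier_def)
  from supporting_hyperplane_rel_boundary[OF K(2) this]
  obtain a where a: "a \<noteq> 0" "\<And>y. y \<in> K \<Longrightarrow> a \<bullet> z \<le> a \<bullet> y" by metis
  show ?thesis
  proof
    show "norm (- sgn a) = 1" using a by (simp add: norm_sgn)
    show "- sgn a \<bullet> k \<le> - sgn a \<bullet> z" if "k \<in> K" for k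
      using a(2)[OF that] by (simp add: sgn_div_norm mult_left_mono)
  qed
qed

text \<open>A half-space bounded through \<open>p\<close> that contains \<open>K\<close> contains
  the hull, and thickening by \<open>\<rho>\<close> moves its boundary by \<open>\<rho>\<close>. The
  normal \<open>v\<close> is not normalised, so that tilted directions can be inserted
  directly.\<close>

lemma parallel_hull_halfspace:
  fixes K :: "'a::euclidean_space set"
  assumes "compact K" "\<And>k. k \<in> K \<Longrightarrow> v \<bullet> k \<le> v \<bullet> p"
    and "infdist x (convex hull (insert p K)) \<le> \<rho>"
  shows "v \<bullet> x \<le> v \<bullet> p + \<rho> * norm v"
proof -
  let ?L = "convex hull (insert p K)"
  have "compact ?L" "?L \<noteq> {}" using assms(1) by (auto intro: compact_convex_hull)
  from parallel_body_eq[OF this, of \<rho>] assms(3)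
  obtain l u where lu: "l \<in> ?L" "norm u \<le> \<rho>" "x = l + u"
    by (auto simp: set_eq_iff)
  have "?L \<subseteq> {x. v \<bullet> x \<le> v \<bullet> p}"
    using assms(2) by (intro hull_minimal) (auto simp: convex_halfspace_le)
  then have "v \<bullet> l \<le> v \<bullet> p" using lu by auto
  moreover have "v \<bullet> u \<le> \<rho> * norm v"
    using norm_cauchy_schwarz[of v u] mult_right_mono[OF lu(2), of "norm v"] by (simp add: mult.commute)
  ultimately show ?thesis using lu by (simp add: inner_add_right)
qed

text \<open>A point \<open>p\<close> placed just outside \<open>K\<close> is a vertex of the hull of \<open>K\<close> and \<open>p\<close>; a thin
  parallel body of the hull is \<open>C\<^sup>1\<close>-regular but carries a spherical cap of small radius around \<open>p\<close>.\<close>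

lemma exists_C1_regular_spike:
  fixes K :: "'a::euclidean_space set"
  assumes dim: "2 \<le> DIM('a)" and K: "convex_body K" and z: "z \<in> frontier K"
    and "0 < \<epsilon>" "0 < R"
  obtains L w where "C1_regular_convex_body L" "hausdist K L < \<epsilon>"
    "w \<in> frontier L" "dist z w < \<epsilon>" "\<not> inner_ball_at L R w"
proof -
  have cK: "compact K" "convex K" "closed K" using K by (auto simp: convex_body_def compact_imp_closed)
  have "z \<in> K" using z cK by (auto simp: frontier_def)
  then have Kne: "K \<noteq> {}" by auto
  obtain \<nu> where \<nu>: "norm \<nu> = 1" "\<And>k. k \<in> K \<Longrightarrow> \<nu> \<bullet> k \<le> \<nu> \<bullet> z"
    using convex_body_outer_normal[OF K z] by blast
  then have \<nu>\<nu>: "\<nu> \<bullet> \<nu> = 1" by (simp flip: power2_norm_eq_inner)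
  define \<delta> where "\<delta> = \<epsilon> / 3"
  \<comment> \<open>The bounds by \<open>\<epsilon> / 3\<close> keep the total displacement
    \<open>\<delta> + \<rho>\<close> below \<open>\<epsilon>\<close>; the bound by
    \<open>R / 2\<close> makes the rounding sharper than a ball of radius \<open>R\<close>.\<close>
  define \<rho> where "\<rho> = min (\<epsilon> / 3) (R / 2)"
  have pos: "0 < \<delta>" "0 < \<rho>" "\<rho> < R" "\<delta> + \<rho> < \<epsilon>"
    using \<open>0 < \<epsilon>\<close> \<open>0 < R\<close> by (auto simp: \<delta>_def \<rho>_def min_def)
  define p where "p = z + \<delta> *\<^sub>R \<nu>"
  define L0 where "L0 = convex hull (insert p K)"
  define L where "L = {x. infdist x L0 \<le> \<rho>}"
  define w where "w = p + \<rho> *\<^sub>R \<nu>"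
  have L0: "compact L0" "convex L0" "L0 \<noteq> {}" "K \<subseteq> L0" "p \<in> L0"
    using cK hull_subset[of "insert p K" convex] by (auto simp: L0_def intro!: compact_convex_hull)
  have Lreg: "C1_regular_convex_body L"
    unfolding L_def by (rule C1_regular_parallel_body[OF L0(1-3) pos(2)])
  have supp: "v \<bullet> x \<le> v \<bullet> p + \<rho> * norm v" if "\<And>k. k \<in> K \<Longrightarrow> v \<bullet> k \<le> v \<bullet> p" "x \<in> L" for v x
    using parallel_hull_halfspace[OF cK(1) that(1)] that(2) by (auto simp: L_def L0_def)
  have \<nu>p: "\<nu> \<bullet> k \<le> \<nu> \<bullet> p - \<delta>" if "k \<in> K" for k
    using \<nu>(2)[OF that] pos by (simp add: p_def inner_add_right \<nu>\<nu>)
  have \<nu>L: "\<nu> \<bullet> x \<le> \<nu> \<bullet> p + \<rho>" if "x \<in> L" for x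
    using supp[of \<nu> x] \<nu>p that \<nu> pos by fastforce
  have "K \<subseteq> L" using L0 pos by (auto simp: L_def)
  have "w \<in> L" using L0 pos \<nu> by (auto simp: L_def w_def dist_norm intro!: infdist_le2[of p])
  moreover have "w \<notin> interior L"
  proof
    assume "w \<in> interior L"
    then obtain d where d: "d > 0" "cball w d \<subseteq> L" by (meson mem_interior_cball)
    then have "w + d *\<^sub>R \<nu> \<in> L" using \<nu> by (auto simp: dist_norm subset_iff)
    from \<nu>L[OF this] show False using d by (simp add: w_def inner_add_right \<nu>\<nu>)
  qed
  ultimately have wf: "w \<in> frontier L" using closure_subset by (auto simp: frontier_def)
  have "dist z w = \<delta> + \<rho>"
  proof -
    have "z - w = - (\<delta> + \<rho>) *\<^sub>R \<nu>" by (simp add: w_def p_def algebra_simps)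
    then show ?thesis using pos \<nu> by (simp add: dist_norm)
  qed
  then have wz: "dist z w < \<epsilon>" using pos by simp
  have "infdist y K \<le> \<delta> + \<rho>" if y: "y \<in> L" for y
  proof -
    obtain l u where lu: "l \<in> L0" "norm u \<le> \<rho>" "y = l + u"
      using y parallel_body_eq[OF L0(1,3), of \<rho>] by (auto simp: set_eq_iff L_def)
    have "L0 \<subseteq> {x. infdist x K \<le> \<delta>}"
      unfolding L0_def
    proof (intro hull_minimal convex_parallel_body cK Kne)
      have "infdist p K \<le> \<delta>"
        using pos \<nu> by (intro infdist_le2[OF \<open>z \<in> K\<close>]) (simp add: p_def dist_norm)
      then show "insert p K \<subseteq> {x. infdist x K \<le> \<delta>}" using pos by auto
    qed
    then have "infdist l K \<le> \<delta>" using lu by auto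
    then show ?thesis using infdist_triangle[of y K l] lu by (simp add: dist_norm)
  qed
  moreover have "infdist x L \<le> \<delta> + \<rho>" if "x \<in> K" for x
    using that \<open>K \<subseteq> L\<close> pos by (auto simp: subset_iff)
  moreover have "bounded K" "bounded L" "L \<noteq> {}"
    using cK C1_regular_convex_body_compact[OF Lreg] C1_regular_convex_body_nonempty[OF Lreg]
    by (auto intro: compact_imp_bounded)
  ultimately have "hausdist K L \<le> \<delta> + \<rho>"
    using Kne by (subst hausdist_le_iff) auto
  then have HL: "hausdist K L < \<epsilon>" using pos by simp
  have "\<not> inner_ball_at L R w"
  proof
    assume "inner_ball_at L R w"
    then obtain c where c: "cball c R \<subseteq> L" "dist c w = R" by (auto simp: inner_ball_at_def)
    \<comment> \<open>The point of the ball around \<open>c\<close> that is extreme in direction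
      \<open>v\<close> must still satisfy the support bound of \<open>L\<close>.\<close>
    have supc: "(c - p) \<bullet> v \<le> (\<rho> - R) * norm v" if "\<And>k. k \<in> K \<Longrightarrow> v \<bullet> k \<le> v \<bullet> p" "v \<noteq> 0" for v
    proof -
      have "c + R *\<^sub>R sgn v \<in> L"
        using c(1) \<open>0 < R\<close> \<open>v \<noteq> 0\<close> by (auto simp: subset_iff dist_norm norm_sgn)
      from supp[OF that(1) this]
      have "v \<bullet> c + R * (v \<bullet> sgn v) \<le> v \<bullet> p + \<rho> * norm v" by (simp add: inner_add_right)
      moreover have "v \<bullet> sgn v = norm v"
        using \<open>v \<noteq> 0\<close> by (simp add: sgn_div_norm flip: power2_norm_eq_inner) (simp add: power2_eq_square)
      ultimately show ?thesis by (simp add: inner_diff_left inner_commute algebra_simps)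
    qed
    have "\<nu> \<noteq> 0" using \<nu> by auto
    \<comment> \<open>The direction \<open>\<nu>\<close> gives equality in Cauchy-Schwarz, since
      \<open>c\<close> has distance exactly \<open>R\<close> from \<open>w\<close>; this fixes
      \<open>c\<close>.\<close>
    have "c - w = - R *\<^sub>R \<nu>"
    proof -
      have "(c - p) \<bullet> \<nu> \<le> \<rho> - R" using supc[of \<nu>] \<nu>p \<nu>(1) \<open>\<nu> \<noteq> 0\<close> pos by fastforce
      then have le: "(c - w) \<bullet> \<nu> \<le> - R" by (simp add: w_def inner_diff_left inner_add_left \<nu>\<nu>)
      have "(norm (c - w + R *\<^sub>R \<nu>))\<^sup>2 = (norm (c - w))\<^sup>2 + 2 * R * ((c - w) \<bullet> \<nu>) + R\<^sup>2"
        unfolding power2_norm_eq_inner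
        by (simp add: inner_add_left inner_add_right \<nu>\<nu> inner_commute power2_eq_square algebra_simps)
      also have "\<dots> \<le> R\<^sup>2 + 2 * R * (- R) + R\<^sup>2"
        using c(2) le \<open>0 < R\<close> by (intro add_mono mult_left_mono) (auto simp: dist_norm)
      also have "\<dots> = 0" by (simp add: power2_eq_square)
      finally show ?thesis by (simp add: eq_neg_iff_add_eq_0)
    qed
    then have cp: "c - p = (\<rho> - R) *\<^sub>R \<nu>" by (simp add: w_def algebra_simps)
    \<comment> \<open>In dimension at least 2 the vertex \<open>p\<close> has further normals
      \<open>v\<close> near \<open>\<nu>\<close>. For the centre just determined,
      \<open>supc\<close> fails in such a tilted direction because \<open>norm v > 1\<close> and
      \<open>\<rho> - R < 0\<close>.\<close>
    obtain e where e: "e \<noteq> 0" "orthogonal \<nu> e"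
      using orthogonal_to_vector_exists[OF dim] by blast
    then have \<nu>e: "\<nu> \<bullet> e = 0" "e \<bullet> \<nu> = 0" by (auto simp: orthogonal_def inner_commute)
    obtain D where D: "\<And>k. k \<in> K \<Longrightarrow> norm (k - p) \<le> D" "0 < D"
    proof -
      obtain D where "\<forall>k\<in>K. dist p k \<le> D" using \<open>bounded K\<close> bounded_any_center by blast
      then have "norm (k - p) \<le> max D 1" if "k \<in> K" for k 
        using that by (force simp: dist_norm norm_minus_commute)
      then show ?thesis using that[of "max D 1"] by auto
    qed
    \<comment> \<open>\<open>t\<close> is so small that the tilted direction \<open>v\<close> is still normal to the hull at \<open>p\<close>.\<close>
    define t where "t = \<delta> / (norm e * D)"
    have t: "t > 0" using pos e D by (simp add: t_def)
    define v where "v = \<nu> + t *\<^sub>R e"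
    have "v \<bullet> k \<le> v \<bullet> p" if "k \<in> K" for k
    proof -
      have "t * (e \<bullet> (k - p)) \<le> t * (norm e * D)"
        using t D(1)[OF that] norm_cauchy_schwarz[of e "k - p"] mult_left_mono[OF D(1)[OF that], of "norm e"]
        by (intro mult_left_mono) auto
      also have "\<dots> = \<delta>" using e D by (simp add: t_def)
      finally show ?thesis
        using \<nu>p[OF that] by (simp add: v_def inner_add_left inner_diff_right algebra_simps)
    qed
    moreover have v2: "(norm v)\<^sup>2 = 1 + t\<^sup>2 * (norm e)\<^sup>2"
      unfolding power2_norm_eq_inner
      by (simp add: v_def inner_add_left inner_add_right \<nu>\<nu> \<nu>e power2_eq_square)
    have "(norm v)\<^sup>2 > 1" unfolding v2 using t e by simp
    then have v1: "norm v > 1" by (simp add: power2_eq_square) (smt (verit) mult_le_one norm_ge_zero)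
    ultimately have "(c - p) \<bullet> v \<le> (\<rho> - R) * norm v" using supc[of v] by force
    then have "(\<rho> - R) * 1 \<le> (\<rho> - R) * norm v"
      by (simp add: cp v_def inner_add_right \<nu>\<nu> \<nu>e)
    then show False using v1 pos by (simp add: mult_le_cancel_left)
  qed
  with that Lreg HL wf wz show ?thesis by blast
qed

lemma closest_point_in_frontier:
  fixes L :: "'a::euclidean_space set"
  assumes "closed L" "L \<noteq> {}" "x \<notin> interior L"
  shows "closest_point L x \<in> frontier L"
proof -
  have "closest_point L x \<in> L" using assms by (simp add: closest_point_in_set)
  moreover have "closest_point L x \<notin> interior L"
  proof
    assume *: "closest_point L x \<in> interior L"
    then have "rel_interior L = interior L" "affine hull L = UNIV"
      using rel_interior_nonempty_interior[of L] affine_hull_nonempty_interior[of L] by blast+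
    then show False using closest_point_in_rel_interior[OF assms(1,2), of x] * assms(3) by simp
  qed
  ultimately show ?thesis using closure_subset by (auto simp: frontier_def)
qed

text \<open>If \<open>w\<close> is not interior to \<open>L\<close>, project it to \<open>L\<close>.
  Otherwise follow an outer normal of \<open>K\<close> at \<open>w\<close> until it leaves
  \<open>L\<close>: the exit point is as far from \<open>K\<close> as from \<open>w\<close>, so the
  Hausdorff distance bounds that length.\<close>

lemma frontier_near_frontier:
  fixes K L :: "'a::euclidean_space set"
  assumes K: "convex_body K" and L: "convex_body L" and w: "w \<in> frontier K"
  obtains w' where "w' \<in> frontier L" "dist w w' \<le> hausdist K L"
proof -
  have K': "compact K" "closed K" "bounded K" "K \<noteq> {}" and L': "closed L" "bounded L" "L \<noteq> {}"
    using K L by (auto simp: convex_body_def compact_imp_closed compact_imp_bounded)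
  have "w \<in> K" using w K' by (auto simp: frontier_def)
  show ?thesis
  proof (cases "w \<in> interior L")
    case False
    have "dist w (closest_point L w) = infdist w L"
      using setdist_closest_point[OF L'(1,3), of w] by (simp add: infdist_eq_setdist)
    also have "\<dots> \<le> hausdist K L"
      using K' L' \<open>w \<in> K\<close> by (intro infdist_le_hausdist)
    finally show ?thesis
      using that closest_point_in_frontier[OF L'(1,3) False] by blast
  next
    case True
    obtain \<nu> where \<nu>: "norm \<nu> = 1" "\<And>k. k \<in> K \<Longrightarrow> \<nu> \<bullet> k \<le> \<nu> \<bullet> w"
      using convex_body_outer_normal[OF K w] by blast
    then have "\<nu> \<noteq> 0" by auto
    obtain d where d: "d > 0" "w + d *\<^sub>R \<nu> \<in> frontier L"
      using ray_to_frontier[OF L'(2) True \<open>\<nu> \<noteq> 0\<close>] by metis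
    have "\<nu> \<bullet> \<nu> = 1" using \<nu> by (simp flip: power2_norm_eq_inner)
    then have "d \<le> infdist (w + d *\<^sub>R \<nu>) K"
      using infdist_ge_halfspace[OF \<nu>(2,1) K'(4), of "w + d *\<^sub>R \<nu>"] by (simp add: inner_add_right)
    also have "\<dots> \<le> hausdist L K"
      using K' L' d by (intro infdist_le_hausdist) (auto simp: frontier_def)
    finally have "dist w (w + d *\<^sub>R \<nu>) \<le> hausdist K L"
      using d \<nu> by (simp add: dist_norm hausdist_commute)
    then show ?thesis using that d by blast
  qed
qed

text \<open>Compactness: if bodies converging to \<open>K\<close> had touching balls at boundary
  points converging to \<open>w\<close>, a limit of the centres would give one for \<open>K\<close>
  at \<open>w\<close>.\<close>

lemma not_inner_ball_at_nearby:
  fixes K :: "'a::euclidean_space set"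
  assumes K: "convex_body K" and w: "w \<in> frontier K" "w \<in> Q" "open Q" "\<not> inner_ball_at K R w"
  shows "\<exists>\<eta>>0. \<forall>L. convex_body L \<and> hausdist K L < \<eta> \<longrightarrow> (\<exists>z\<in>frontier L \<inter> Q. \<not> inner_ball_at L R z)"
proof (rule ccontr)
  assume neg: "\<not> ?thesis"
  have K': "closed K" "bounded K" "K \<noteq> {}"
    using K by (auto simp: convex_body_def compact_imp_closed compact_imp_bounded)
  obtain e where e: "e > 0" "ball w e \<subseteq> Q" using w openE by blast
  have "\<exists>L w' c. convex_body L \<and> hausdist K L < e / real (Suc n) \<and> dist w w' < e / real (Suc n)
      \<and> cball c R \<subseteq> L \<and> dist c w' = R" for n
  proof -
    have "e / real (Suc n) > 0" using e by simp
    with neg obtain L where L: "convex_body L" "hausdist K L < e / real (Suc n)"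
      and all: "\<And>z. z \<in> frontier L \<Longrightarrow> z \<in> Q \<Longrightarrow> inner_ball_at L R z"
      by blast
    obtain w' where w': "w' \<in> frontier L" "dist w w' \<le> hausdist K L"
      using frontier_near_frontier[OF K L(1) w(1)] by blast
    have "e / real (Suc n) \<le> e" using e by (simp add: field_simps)
    then have "w' \<in> Q" using w' L e by auto
    then show ?thesis using all[OF w'(1)] L w' unfolding inner_ball_at_def
      by (meson order_le_less_trans)
  qed
  then obtain L w' c where L: "\<And>n. convex_body (L n)" "\<And>n. hausdist K (L n) < e / real (Suc n)"
    and w': "\<And>n. dist w (w' n) < e / real (Suc n)"
    and c: "\<And>n. cball (c n) R \<subseteq> L n" "\<And>n. dist (c n) (w' n) = R"
    by metis
  have lim0: "(\<lambda>n. e / real (Suc n)) \<longlonglongrightarrow> 0"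
    using tendsto_mult_left[OF LIMSEQ_inverse_real_of_nat, of e] by (simp add: divide_inverse)
  have "c n \<in> cball w (e + R)" for n
  proof -
    have "e / real (Suc n) \<le> e" using e by (simp add: field_simps)
    then show ?thesis using dist_triangle[of w "c n" "w' n"] w'[of n] c(2)[of n]
      by (simp add: dist_commute)
  qed
  then obtain a and r :: "nat \<Rightarrow> nat" where a: "strict_mono r" "(c \<circ> r) \<longlonglongrightarrow> a"
    using compact_cball[of w "e + R"] unfolding compact_def by metis
  have lim0r: "(\<lambda>n. e / real (Suc (r n))) \<longlonglongrightarrow> 0"
    using LIMSEQ_subseq_LIMSEQ[OF lim0 a(1)] by (simp add: o_def)
  have "(\<lambda>n. dist w (w' (r n))) \<longlonglongrightarrow> 0"
    by (rule tendsto_sandwich[OF _ _ tendsto_const lim0r]) (use less_imp_le[OF w'] in auto)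
  then have "(\<lambda>n. w' (r n)) \<longlonglongrightarrow> w" by (subst tendsto_dist_iff) (simp add: dist_commute)
  then have "(\<lambda>n. dist (c (r n)) (w' (r n))) \<longlonglongrightarrow> dist a w"
    using a(2) by (intro tendsto_dist) (simp_all add: o_def)
  then have "dist a w = R" using c(2) by (simp add: LIMSEQ_const_iff)
  moreover have "cball a R \<subseteq> K"
  proof
    fix x assume x: "x \<in> cball a R"
    \<comment> \<open>The point \<open>x\<close> is carried along with the moving centres, so that
      it lies in the approximating bodies.\<close>
    have "infdist (x - a + c (r n)) K \<le> e / real (Suc (r n))" for n
    proof -
      have "x - a + c (r n) \<in> L (r n)"
        using x c(1)[of "r n"] by (auto simp: subset_iff dist_norm norm_minus_commute)
      moreover have "bounded (L (r n))" using L(1) by (auto simp: convex_body_def compact_imp_bounded)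
      ultimately have "infdist (x - a + c (r n)) K \<le> hausdist (L (r n)) K"
        using K' by (intro infdist_le_hausdist) auto
      then show ?thesis using L(2)[of "r n"] by (simp add: hausdist_commute)
    qed
    moreover have "(\<lambda>n. infdist (x - a + c (r n)) K) \<longlonglongrightarrow> infdist (x - a + a) K"
      using a(2) by (intro tendsto_intros) (simp add: o_def)
    ultimately have "infdist (x - a + a) K \<le> 0"
      by (intro LIMSEQ_le[OF _ lim0r]) auto
    then show "x \<in> K" using in_closed_iff_infdist_zero[OF K'(1,3), of x] infdist_nonneg[of x K] by simp
  qed
  ultimately show False using w(4) by (auto simp: inner_ball_at_def)
qed

text \<open>Near any member of the set there is a body with a spike inside \<open>Q\<close>, and a
  whole Hausdorff neighbourhood of that body avoids the set. The condition that the boundary meets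
  \<open>Q\<close> supplies the place for the spike and excludes bodies satisfying the rest
  vacuously.\<close>

lemma nowhere_dense_inner_ball_at:
  fixes Q :: "'a::euclidean_space set"
  assumes dim: "2 \<le> DIM('a)" and "open Q" "0 < R"
  shows "nowhere_dense_in C1_regular_convex_body_space
    {K. C1_regular_convex_body K \<and> frontier K \<inter> Q \<noteq> {} \<and> (\<forall>z\<in>frontier K \<inter> Q. inner_ball_at K R z)}"
    (is "nowhere_dense_in ?X ?T")
proof -
  interpret Metric_space "{K :: 'a set. C1_regular_convex_body K}" hausdist
    by (rule Metric_space_C1_regular_convex_body)
  have cb: "convex_body K" if "C1_regular_convex_body K" for K :: "'a set"
    using that by (simp add: C1_regular_convex_body_def)
  have X: "?X = mtopology" by (simp add: C1_regular_convex_body_space_def)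
  have "W = {}" if W: "openin mtopology W" "W \<subseteq> mtopology closure_of ?T" for W
  proof (rule ccontr)
    assume "W \<noteq> {}"
    then have "W \<inter> ?T \<noteq> {}"
      using W openin_Int_closure_of_eq_empty[OF W(1), of ?T] by blast
    then obtain K z where K: "K \<in> W" "C1_regular_convex_body K" and z: "z \<in> frontier K" "z \<in> Q" by blast
    obtain e1 where e1: "e1 > 0" "mball K e1 \<subseteq> W"
      using W(1) K(1) by (auto simp: openin_mtopology)
    obtain e2 where e2: "e2 > 0" "ball z e2 \<subseteq> Q" using z \<open>open Q\<close> openE by blast
    obtain L w where L: "C1_regular_convex_body L" "hausdist K L < min e1 e2"
      "w \<in> frontier L" "dist z w < min e1 e2" "\<not> inner_ball_at L R w"
      using exists_C1_regular_spike[OF dim cb[OF K(2)] z(1), of "min e1 e2" R] e1 e2 \<open>0 < R\<close>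
      by (metis min_less_iff_conj)
    then have "L \<in> mball K e1" "w \<in> Q" using K e2 by auto
    then have "L \<in> mtopology closure_of ?T" using e1 W by auto
    obtain \<eta> where \<eta>: "\<eta> > 0"
      "\<And>M. convex_body M \<Longrightarrow> hausdist L M < \<eta> \<Longrightarrow> \<exists>z\<in>frontier M \<inter> Q. \<not> inner_ball_at M R z"
      using not_inner_ball_at_nearby[OF cb[OF L(1)] L(3) \<open>w \<in> Q\<close> \<open>open Q\<close> L(5)] by blast
    obtain M where M: "M \<in> ?T" "M \<in> mball L \<eta>"
      using \<open>L \<in> mtopology closure_of ?T\<close> \<eta>(1) unfolding metric_closure_of by blast
    then have "convex_body M" "hausdist L M < \<eta>" using cb by auto
    with \<eta>(2) M(1) show False by blast
  qed
  then have "mtopology interior_of (mtopology closure_of ?T) = {}"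
    by (meson interior_of_subset openin_interior_of)
  then show ?thesis
    unfolding nowhere_dense_in_def X by auto
qed

subsection \<open>Level sets of the distance to the complement\<close>

text \<open>Along a curve in \<open>M\<close> through \<open>x\<close>, the image of a line in
  \<open>Z\<close>, the function \<open>n \<bullet> (m - x)\<close> has a maximum at
  \<open>x\<close>. Hence each normal is orthogonal to the tangent space, whose dimension
  \<open>DIM('a) - 1\<close> leaves room for one line. The factor \<open>k\<close> may have either
  sign.\<close>

lemma C1_hypersurface_normals_collinear:
  fixes M C :: "'a::euclidean_space set"
  assumes M: "C1_hypersurface M" "M \<subseteq> C" "x \<in> M"
    and n1: "\<And>m. m \<in> C \<Longrightarrow> n1 \<bullet> (m - x) \<le> 0" "n1 \<noteq> 0"
    and n2: "\<And>m. m \<in> C \<Longrightarrow> n2 \<bullet> (m - x) \<le> 0"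
  obtains k where "n2 = k *\<^sub>R n1"
proof -
  obtain V Z and \<sigma> :: "'a \<Rightarrow> 'a" where V: "open V" "x \<in> V" and Z: "subspace Z" "dim Z = DIM('a) - 1"
    and \<sigma>: "C1_diffeomorphism_onto V (\<sigma> ` V) \<sigma>" "\<sigma> ` (V \<inter> M) = Z \<inter> \<sigma> ` V"
    using M unfolding C1_hypersurface_def by blast
  define \<tau> where "\<tau> = inv_into V \<sigma>"
  have oW: "open (\<sigma> ` V)" and inj: "inj_on \<sigma> V" and C1: "C1_map_on \<sigma> V" "C1_map_on \<tau> (\<sigma> ` V)"
    using \<sigma>(1) by (auto simp: C1_diffeomorphism_onto_def bij_betw_def \<tau>_def)
  have \<tau>\<sigma>: "\<tau> (\<sigma> v) = v" if "v \<in> V" for v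
    using that inj by (simp add: \<tau>_def)
  obtain D where D: "(\<tau> has_derivative blinfun_apply D) (at (\<sigma> x))"
    using C1(2) V(2) unfolding C1_map_on_def by blast
  obtain E where E: "(\<sigma> has_derivative blinfun_apply E) (at x)"
    using C1(1) V(2) unfolding C1_map_on_def by blast
  have "((\<lambda>v. \<tau> (\<sigma> v)) has_derivative (\<lambda>h. D (E h))) (at x)"
    by (rule has_derivative_compose[OF E D])
  then have "((\<lambda>v. v) has_derivative (\<lambda>h. D (E h))) (at x)"
    by (rule has_derivative_transform_within_open[OF _ V]) (simp add: \<tau>\<sigma>)
  then have "(\<lambda>h. D (E h)) = (\<lambda>h. h)"
    by (rule has_derivative_unique[OF _ has_derivative_ident])
  then have DE: "D (E h) = h" for h by meson
  have linD: "linear (blinfun_apply D)" by (simp add: blinfun.bounded_linear_right bounded_linear.linear)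
  have "surj (blinfun_apply D)" using DE by (metis surjI)
  then have injD: "inj (blinfun_apply D)" using linD linear_surjective_imp_injective by blast
  have \<sigma>x: "\<sigma> x \<in> Z" using \<sigma>(2) V M(3) by blast
  have tangent: "n \<bullet> D z = 0" if z: "z \<in> Z" and n: "\<And>m. m \<in> C \<Longrightarrow> n \<bullet> (m - x) \<le> 0" for n z
  proof -
    let ?\<gamma> = "\<lambda>t::real. \<sigma> x + t *\<^sub>R z"
    have \<gamma>: "(?\<gamma> has_derivative (\<lambda>t. t *\<^sub>R z)) (at 0)" by (auto intro!: derivative_eq_intros)
    have "(\<tau> has_derivative blinfun_apply D) (at (\<sigma> x + 0 *\<^sub>R z))" using D by simp
    from has_derivative_compose[OF \<gamma> this]
    have "((\<lambda>t. \<tau> (?\<gamma> t)) has_derivative (\<lambda>t. D (t *\<^sub>R z))) (at 0)" .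
    then have der: "((\<lambda>t. n \<bullet> (\<tau> (?\<gamma> t) - x)) has_real_derivative n \<bullet> D z) (at 0)"
      unfolding has_field_derivative_def
      by (auto intro!: derivative_eq_intros simp: blinfun.scaleR_right mult.commute fun_eq_iff)
    have "continuous (at 0) ?\<gamma>" by (intro continuous_intros)
    then obtain d where d: "d > 0" "\<And>t. \<bar>t\<bar> < d \<Longrightarrow> ?\<gamma> t \<in> \<sigma> ` V"
      using oW V(2) unfolding continuous_at_open
      by (metis (no_types, lifting) add.right_neutral dist_0_norm dist_commute eventually_at_topological
          imageI open_dist real_norm_def scaleR_zero_left)
    have "n \<bullet> (\<tau> (?\<gamma> t) - x) \<le> n \<bullet> (\<tau> (?\<gamma> 0) - x)" if "\<bar>0 - t\<bar> < d" for t
    proof -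
      have "?\<gamma> t \<in> Z" using Z(1) \<sigma>x z by (simp add: subspace_add subspace_scale)
      then have "?\<gamma> t \<in> \<sigma> ` (V \<inter> M)" using d(2)[of t] that \<sigma>(2) by auto
      then have "\<tau> (?\<gamma> t) \<in> M" using \<tau>\<sigma> by auto
      then show ?thesis using n M(2) \<tau>\<sigma>[OF V(2)] by auto
    qed
    then show ?thesis using DERIV_local_max[OF der d(1)] by blast
  qed
  define k where "k = (n1 \<bullet> n2) / (n1 \<bullet> n1)"
  \<comment> \<open>The Gram-Schmidt remainder of \<open>n2\<close>; if it were non-zero,
    \<open>n1\<close>, \<open>u\<close> and the tangent space would span too many
    dimensions.\<close>
  define u where "u = n2 - k *\<^sub>R n1"
  have un1: "n1 \<bullet> u = 0" using n1(2) by (simp add: u_def k_def inner_diff_right)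
  have "u = 0"
  proof (rule ccontr)
    assume "u \<noteq> 0"
    have "n1 \<bullet> D z = 0" "n2 \<bullet> D z = 0" if "z \<in> Z" for z
      using tangent[OF that] n1(1) n2 by auto
    then have "dim ((D ` Z) \<union> {n1, u}) = dim (D ` Z) + dim {n1, u}"
      by (intro dim_orthogonal_sum) (auto simp: u_def inner_diff_right inner_commute[of "blinfun_apply D _"])
    moreover have "dim (D ` Z) = DIM('a) - 1"
      using dim_image_eq[OF linD, of Z] injD Z by (simp add: inj_on_subset[OF injD])
    moreover have "dim {n1, u} = 2"
    proof -
      have "n1 \<noteq> u" using un1 n1(2) by auto
      have "independent {n1, u}"
        using un1 n1(2) \<open>u \<noteq> 0\<close> 
        by (intro pairwise_orthogonal_independent) (auto simp: pairwise_def orthogonal_def inner_commute)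
      then show ?thesis using \<open>n1 \<noteq> u\<close> by (simp add: dim_eq_card_independent)
    qed
    moreover have "dim ((D ` Z) \<union> {n1, u}) \<le> DIM('a)" by (rule dim_subset_UNIV)
    ultimately show False using DIM_positive[where 'a='a] by linarith
  qed
  then have "n2 = k *\<^sub>R n1" by (simp add: u_def)
  then show ?thesis by (rule that)
qed

definition inner_parallel_body :: "'a::metric_space set \<Rightarrow> real \<Rightarrow> 'a set" where
  "inner_parallel_body K r = {x. cball x r \<subseteq> K}"

lemma inner_parallel_body_eq_Inter:
  fixes K :: "'a::real_normed_vector set"
  shows "inner_parallel_body K r = (\<Inter>u\<in>cball 0 r. (+) (- u) ` K)"
proof -
  have "cball x r \<subseteq> K \<longleftrightarrow> (\<forall>u\<in>cball 0 r. x + u \<in> K)" for x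
  proof -
    have "y = x + (y - x)" "y - x \<in> cball 0 r \<longleftrightarrow> y \<in> cball x r" for y
      by (auto simp: dist_norm norm_minus_commute)
    moreover have "x + u \<in> cball x r" if "u \<in> cball 0 r" for u
      using that by (simp add: dist_norm)
    ultimately show ?thesis by (metis subset_iff)
  qed
  moreover have "x \<in> (+) (- u) ` K \<longleftrightarrow> x + u \<in> K" for x u
    by (force simp: image_iff algebra_simps)
  ultimately show ?thesis by (auto simp: inner_parallel_body_def)
qed

lemma closed_inner_parallel_body:
  fixes K :: "'a::real_normed_vector set"
  assumes "closed K"
  shows "closed (inner_parallel_body K r)"
  unfolding inner_parallel_body_eq_Inter by (intro closed_INT ballI closed_translation assms)

lemma convex_inner_parallel_body:
  fixes K :: "'a::real_normed_vector set"
  assumes "convex K"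
  shows "convex (inner_parallel_body K r)"
  unfolding inner_parallel_body_eq_Inter by (intro convex_INT convex_translation assms)

lemma dist_inner_parallel_frontier:
  fixes K :: "'a::metric_space set"
  assumes "x \<in> inner_parallel_body K r" "y \<in> frontier K"
  shows "r \<le> dist x y"
proof (rule ccontr)
  assume "\<not> ?thesis"
  then have "y \<in> ball x r" by simp
  moreover have "ball x r \<subseteq> interior K"
    using assms(1) ball_subset_cball[of x r] by (intro interior_maximal) (auto simp: inner_parallel_body_def)
  ultimately show False using assms(2) by (auto simp: frontier_def)
qed

text \<open>Closedness of \<open>K\<close> passes from the open to the closed ball. The case
  \<open>K = UNIV\<close> is excluded because \<open>infdist\<close> to the empty set is 0 by
  convention.\<close>

lemma mem_inner_parallel_body_iff:
  fixes K :: "'a::euclidean_space set"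
  assumes "closed K" "0 < r" "K \<noteq> UNIV"
  shows "x \<in> inner_parallel_body K r \<longleftrightarrow> r \<le> infdist x (- K)"
proof
  assume "r \<le> infdist x (- K)"
  then have "ball x r \<subseteq> K"
    using infdist_le[of _ "- K" x] by (force simp: not_le[symmetric])
  then have "closure (ball x r) \<subseteq> K" using assms(1) by (rule closure_minimal)
  then show "x \<in> inner_parallel_body K r" using assms(2) by (simp add: inner_parallel_body_def)
next
  assume "x \<in> inner_parallel_body K r"
  then have "r \<le> dist x y" if "y \<in> - K" for y
    using that by (force simp: not_le[symmetric] inner_parallel_body_def)
  moreover have "- K \<noteq> {}" using assms(3) by auto
  ultimately show "r \<le> infdist x (- K)"
    unfolding infdist_def by (auto intro: cINF_greatest)
qed

text \<open>The infimum is attained on the closure of the complement; the minimiser also lies in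
  \<open>K\<close>, since the closed \<open>r\<close>-ball around \<open>x\<close> does.\<close>

lemma exists_foot_point:
  fixes K :: "'a::euclidean_space set"
  assumes "closed K" "0 < r" "K \<noteq> UNIV" "infdist x (- K) = r"
  obtains y where "y \<in> frontier K" "dist x y = r"
proof -
  have "closure (- K) \<noteq> {}" using assms by auto
  from infdist_attains_inf[OF closed_closure this, of x]
  obtain y where y: "y \<in> closure (- K)" "infdist x (closure (- K)) = dist x y" by blast
  have "infdist x (closure (- K)) = r" using assms(4) by (simp add: infdist_eq_setdist)
  with y have xy: "dist x y = r" by simp
  have "cball x r \<subseteq> K"
    using mem_inner_parallel_body_iff[OF assms(1-3), of x] assms(4) by (simp add: inner_parallel_body_def)
  then have "y \<in> K" using xy by auto
  then have "y \<in> frontier K" using y closure_subset by (auto simp: frontier_closures)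
  then show ?thesis using that xy by blast
qed

text \<open>The nearest point lies on the boundary of the inner parallel body, and points at depth
  greater than \<open>r\<close> are interior to that body.\<close>

lemma infdist_compl_closest_point:
  fixes K :: "'a::euclidean_space set"
  assumes "convex_body K" "0 < r" "z \<in> frontier K" "inner_parallel_body K r \<noteq> {}"
  shows "infdist (closest_point (inner_parallel_body K r) z) (- K) = r"
proof -
  let ?C = "inner_parallel_body K r"
  have K: "closed K" "K \<noteq> UNIV"
    using assms(1) by (auto simp: convex_body_def compact_imp_closed compact_imp_bounded)
  note mem_iff = mem_inner_parallel_body_iff[OF K(1) assms(2) K(2)]
  have C: "closed ?C" by (rule closed_inner_parallel_body[OF K(1)])
  have "z \<notin> ?C" using dist_inner_parallel_frontier[of z K r z] assms(2,3) by auto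
  then have "closest_point ?C z \<in> frontier ?C"
    using closest_point_in_frontier[OF C assms(4)] interior_subset by blast
  then have p: "closest_point ?C z \<in> ?C" "closest_point ?C z \<notin> interior ?C"
    using C by (auto simp: frontier_def)
  have "{x. r < infdist x (- K)} \<subseteq> interior ?C"
    by (intro interior_maximal open_Collect_less continuous_intros) (auto simp: mem_iff)
  then have "infdist (closest_point ?C z) (- K) \<le> r" using p(2) not_less by blast
  then show ?thesis using p(1) mem_iff by fastforce
qed

text \<open>Every point of the inner parallel body is at least \<open>r\<close> away from
  \<open>y\<close>, and \<open>x\<close> attains this; convexity makes the minimiser unique.\<close>

lemma closest_point_inner_parallel:
  fixes K :: "'a::euclidean_space set"
  assumes "convex K" "closed K" "x \<in> inner_parallel_body K r" "y \<in> frontier K" "dist x y = r"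
  shows "closest_point (inner_parallel_body K r) y = x"
  using dist_inner_parallel_frontier[OF _ assms(4), of _ r] assms(3,5)
  by (intro closest_point_unique[symmetric] convex_inner_parallel_body closed_inner_parallel_body assms ballI)
    (simp add: dist_commute)

text \<open>Both \<open>y\<close> and \<open>z\<close> lie on the normal line of \<open>M\<close> at \<open>x\<close>; if they were on the same ray and
  distinct, \<open>y\<close> would be interior to \<open>K\<close>.\<close>

lemma opposite_foot_points:
  fixes K :: "'a::euclidean_space set"
  assumes K: "convex_body K" and r: "0 < r"
    and M: "C1_hypersurface M" "M \<subseteq> inner_parallel_body K r" "x \<in> M"
    and z: "z \<in> frontier K" "x = closest_point (inner_parallel_body K r) z" "\<not> inner_ball_at K r z"
    and y: "y \<in> frontier K" "dist x y = r"
  shows "y = x - r *\<^sub>R sgn (z - x)"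
proof -
  let ?C = "inner_parallel_body K r"
  have K': "closed K" "convex K" using K by (auto simp: convex_body_def compact_imp_closed)
  have C: "closed ?C" "convex ?C"
    using K' by (auto intro: closed_inner_parallel_body convex_inner_parallel_body)
  have xC: "x \<in> ?C" using M by auto
  have xy: "x = closest_point ?C y"
    using closest_point_inner_parallel[OF K'(2,1) xC y] by simp
  have nz: "(z - x) \<bullet> (m - x) \<le> 0" if "m \<in> ?C" for m
    using closest_point_dot[OF C(2,1) that, of z] z(2) by simp
  have ny: "(y - x) \<bullet> (m - x) \<le> 0" if "m \<in> ?C" for m
    using closest_point_dot[OF C(2,1) that, of y] xy by simp
  have "y - x \<noteq> 0" using y r by auto
  from C1_hypersurface_normals_collinear[OF M ny this nz]
  obtain k where k: "z - x = k *\<^sub>R (y - x)" by blast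
  have nyx: "norm (y - x) = r" using y by (simp add: dist_norm norm_minus_commute)
  have "r \<le> norm (z - x)" using dist_inner_parallel_frontier[OF xC z(1)] by (simp add: dist_norm norm_minus_commute)
  then have "r \<le> \<bar>k\<bar> * r" using k nyx by simp
  then have k1: "1 \<le> \<bar>k\<bar>" using r by simp
  have "k < 0"
  proof (rule ccontr)
    assume "\<not> k < 0"
    then have "1 \<le> k" using k1 by auto
    have cb: "cball x r \<subseteq> K" using xC by (simp add: inner_parallel_body_def)
    \<comment> \<open>For \<open>k = 1\<close> the points \<open>z\<close> and \<open>y\<close>
      coincide, and the ball around \<open>x\<close> touches the boundary at
      \<open>z\<close>.\<close>
    have "k \<noteq> 1" using z(3) k y cb by (auto simp: inner_ball_at_def)
    then have "1 < k" using \<open>1 \<le> k\<close> by simp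
    have "x \<in> interior K" using cb r by (auto simp: mem_interior_cball)
    moreover have "z \<in> K" using z(1) K' by (auto simp: frontier_def)
    moreover have "y = z - (1 - 1 / k) *\<^sub>R (z - x)"
    proof -
      have "(1 / k) *\<^sub>R (z - x) = y - x" using k \<open>1 < k\<close> by simp
      then show ?thesis by (simp add: scaleR_left_diff_distrib)
    qed
    ultimately have "y \<in> interior K"
      using mem_interior_convex_shrink[OF K'(2), of x z "1 - 1 / k"] \<open>1 < k\<close> by simp
    then show False using y by (auto simp: frontier_def)
  qed
  then have "sgn (z - x) = - ((1 / r) *\<^sub>R (y - x))"
    unfolding k using nyx r by (simp add: sgn_scaleR sgn_div_norm divide_inverse)
  then show ?thesis using r by simp
qed

text \<open>A point \<open>z\<close> without a touching ball forces the foot point of its projection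
  \<open>x1\<close> to be a single point \<open>y1\<close>, opposite to \<open>z\<close>.
  Approximating \<open>y1\<close> by points of the same kind shows that the reflection of
  \<open>y1\<close> in \<open>x1\<close> is a foot point as well, which contradicts
  uniqueness.\<close>

lemma not_C1_hypersurface_level_set:
  fixes K :: "'a::euclidean_space set"
  assumes K: "convex_body K" and r: "0 < r" and U: "open U"
    and dense: "\<And>Q. open Q \<Longrightarrow> frontier K \<inter> Q \<noteq> {} \<Longrightarrow> \<exists>z\<in>frontier K \<inter> Q. \<not> inner_ball_at K r z"
  shows "\<not> C1_hypersurface (U \<inter> {x. infdist x (- K) = r})"
proof
  let ?M = "U \<inter> {x. infdist x (- K) = r}" and ?C = "inner_parallel_body K r"
  let ?p = "closest_point ?C"
  assume M: "C1_hypersurface ?M"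
  have K': "closed K" "convex K" "K \<noteq> UNIV"
    using K by (auto simp: convex_body_def compact_imp_closed compact_imp_bounded)
  have MC: "?M \<subseteq> ?C" using mem_inner_parallel_body_iff[OF K'(1) r K'(3)] by auto
  obtain x0 where x0: "x0 \<in> ?M" using M by (auto simp: C1_hypersurface_def)
  then have Cne: "?C \<noteq> {}" using MC by auto
  have C: "closed ?C" "convex ?C"
    using K' by (auto intro: closed_inner_parallel_body convex_inner_parallel_body)
  have pcont: "continuous_on UNIV ?p" by (rule continuous_on_closest_point[OF C(2,1) Cne])
  have oU: "open (?p -` U)" using continuous_open_vimage[OF U] pcont
    by (metis continuous_on_eq_continuous_at open_UNIV UNIV_I)
  have foot: "\<exists>y\<in>frontier K. dist x y = r" if "x \<in> ?M" for x
    using exists_foot_point[OF K'(1) r K'(3), of x] that by blast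
  have pM: "?p z \<in> ?M" if "z \<in> frontier K" "?p z \<in> U" for z
    using infdist_compl_closest_point[OF K r that(1) Cne] that by auto
  have py: "?p y = x" if "x \<in> ?M" "y \<in> frontier K" "dist x y = r" for x y
    using closest_point_inner_parallel[OF K'(2,1) _ that(2,3)] MC that(1) by auto
  have opp: "y = ?p z - r *\<^sub>R sgn (z - ?p z)"
    if "z \<in> frontier K" "?p z \<in> U" "\<not> inner_ball_at K r z" "y \<in> frontier K" "dist (?p z) y = r" for y z
    using opposite_foot_points[OF K r M MC pM[OF that(1,2)] that(1) refl that(3,4,5)] .
  obtain y0 where y0: "y0 \<in> frontier K" "dist x0 y0 = r" using foot[OF x0] by blast
  have "frontier K \<inter> ?p -` U \<noteq> {}" using py[OF x0 y0] x0 y0 by auto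
  then obtain z where z: "z \<in> frontier K" "?p z \<in> U" "\<not> inner_ball_at K r z"
    using dense[OF oU] by blast
  define x1 where "x1 = ?p z"
  have x1: "x1 \<in> ?M" unfolding x1_def using pM z by blast
  obtain y1 where y1: "y1 \<in> frontier K" "dist x1 y1 = r" using foot[OF x1] by blast
  have y1_eq: "y1 = x1 - r *\<^sub>R sgn (z - x1)" unfolding x1_def by (rule opp[OF z]) (use y1 x1_def in auto)
  have py1: "?p y1 = x1" by (rule py[OF x1 y1])
  have "\<exists>w. w \<in> frontier K \<and> ?p w \<in> U \<and> \<not> inner_ball_at K r w \<and> dist y1 w < 1 / real (Suc n)" for n
  proof -
    let ?Q = "?p -` U \<inter> ball y1 (1 / real (Suc n))"
    have "y1 \<in> frontier K \<inter> ?Q"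
      using y1 py1 x1 by simp
    moreover have "open ?Q" using oU by (intro open_Int) auto
    ultimately obtain w where "w \<in> frontier K \<inter> ?Q" "\<not> inner_ball_at K r w"
      using dense[of ?Q] by blast
    then show ?thesis by (intro exI[of _ w]) auto
  qed
  then obtain w where w: "\<And>n. w n \<in> frontier K" "\<And>n. ?p (w n) \<in> U" "\<And>n. \<not> inner_ball_at K r (w n)"
    "\<And>n. dist y1 (w n) < 1 / real (Suc n)" by metis
  have "(\<lambda>n. dist y1 (w n)) \<longlonglongrightarrow> 0"
    by (rule tendsto_sandwich[OF _ _ tendsto_const LIMSEQ_Suc[OF lim_1_over_n]])
      (use less_imp_le[OF w(4)] in auto)
  then have wlim: "w \<longlonglongrightarrow> y1" by (subst tendsto_dist_iff) (simp add: dist_commute)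
  then have plim: "(\<lambda>n. ?p (w n)) \<longlonglongrightarrow> x1"
    using continuous_on_tendsto_compose[OF pcont wlim] py1 by simp
  define y' where "y' = (\<lambda>n. ?p (w n) - r *\<^sub>R sgn (w n - ?p (w n)))"
  \<comment> \<open>The projection of \<open>w n\<close> has some foot point on the boundary, and
    \<open>opp\<close> identifies it as \<open>y' n\<close>.\<close>
  have y': "y' n \<in> frontier K" for n
    using foot[OF pM[OF w(1,2)], of n] opp[OF w(1-3), of _ n] by (auto simp: y'_def)
  have "y1 - x1 \<noteq> 0" using y1 r by auto
  then have "y' \<longlonglongrightarrow> x1 - r *\<^sub>R sgn (y1 - x1)"
    unfolding y'_def by (intro tendsto_intros wlim plim)
  moreover have "r *\<^sub>R sgn (y1 - x1) = y1 - x1"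
    using y1 r by (simp add: sgn_div_norm dist_norm norm_minus_commute)
  ultimately have "y' \<longlonglongrightarrow> x1 - (y1 - x1)" by simp
  \<comment> \<open>The opposite foot points \<open>y' n\<close> converge to the reflection of
    \<open>y1\<close>, and the boundary is closed.\<close>
  then have "x1 - (y1 - x1) \<in> frontier K"
    using closed_sequentially[OF frontier_closed] y' by blast
  moreover have "dist x1 (x1 - (y1 - x1)) = r" using y1 by (simp add: dist_norm norm_minus_commute)
  ultimately have "x1 - (y1 - x1) = x1 - r *\<^sub>R sgn (z - x1)"
    unfolding x1_def using opp[OF z] by blast
  then have "x1 - (y1 - x1) = y1" using y1_eq by simp
  then have "2 *\<^sub>R (y1 - x1) = 0" by (simp add: algebra_simps scaleR_2)
  with \<open>y1 - x1 \<noteq> 0\<close> show False by simp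
qed

subsection \<open>Genericity\<close>

lemma nowhere_dense_in_subset:
  assumes "nowhere_dense_in X T" "S \<subseteq> T"
  shows "nowhere_dense_in X S"
proof -
  have "X interior_of (X closure_of S) \<subseteq> X interior_of (X closure_of T)"
    by (intro interior_of_mono closure_of_mono assms)
  then show ?thesis using assms unfolding nowhere_dense_in_def by blast
qed

theorem corollary2p8:
  assumes "CARD('n::finite) \<ge> 2"
  shows "generic_C1_regular_convex_body
           (\<lambda>K :: (real ^ 'n) set.
              \<forall>U r. open U \<longrightarrow> 0 < r \<longrightarrow> \<not> C1_hypersurface (U \<inter> {x. infdist x (- K) = r}))"
proof -
  define T where "T Q m = {K :: (real ^ 'n) set. C1_regular_convex_body K \<and> frontier K \<inter> Q \<noteq> {} \<and>
    (\<forall>z\<in>frontier K \<inter> Q. inner_ball_at K (1 / real (Suc m)) z)}" for Q m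
  define N where "N = {K :: (real ^ 'n) set. C1_regular_convex_body K \<and>
    \<not> (\<forall>U r. open U \<longrightarrow> 0 < r \<longrightarrow> \<not> C1_hypersurface (U \<inter> {x. infdist x (- K) = r}))}"
  obtain B :: "(real ^ 'n) set set" where B: "countable B" "topological_basis B"
    using ex_countable_basis by blast
  \<comment> \<open>Intersecting with \<open>N\<close> is necessary because \<open>meagre_in\<close>
    asks for equality with the union, not inclusion.\<close>
  define F where "F = (\<lambda>(Q, m). T Q m \<inter> N) ` (B \<times> UNIV)"
  have "countable F" using B(1) by (auto simp: F_def)
  moreover have "nowhere_dense_in C1_regular_convex_body_space S" if SF: "S \<in> F" for S
  proof -
    obtain Q m where S: "Q \<in> B" "S = T Q m \<inter> N" using SF by (auto simp: F_def)
    have "2 \<le> DIM(real ^ 'n)" using assms by simp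
    from nowhere_dense_inner_ball_at[OF this topological_basis_open[OF B(2) S(1)], of "1 / real (Suc m)"]
    have "nowhere_dense_in C1_regular_convex_body_space (T Q m)" by (simp add: T_def)
    then show ?thesis by (rule nowhere_dense_in_subset) (simp add: S(2))
  qed
  moreover have "N = \<Union>F"
  proof
    show "N \<subseteq> \<Union>F"
    proof
      fix K assume K: "K \<in> N"
      then have reg: "C1_regular_convex_body K" and cb: "convex_body K"
        by (auto simp: N_def C1_regular_convex_body_def)
      obtain U r where U: "open U" "0 < r" "C1_hypersurface (U \<inter> {x. infdist x (- K) = r})"
        using K by (auto simp: N_def)
      then obtain Q where Q: "open Q" "frontier K \<inter> Q \<noteq> {}" "\<And>z. z \<in> frontier K \<inter> Q \<Longrightarrow> inner_ball_at K r z"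
        using not_C1_hypersurface_level_set[OF cb U(2,1)] by blast
      then obtain z where z: "z \<in> frontier K" "z \<in> Q" by blast
      \<comment> \<open>The open set shrinks to a basic one still containing \<open>z\<close>, and
        the radius to some \<open>1 / real (Suc m)\<close>; both keep the touching balls.\<close>
      obtain b where b: "b \<in> B" "z \<in> b" "b \<subseteq> Q"
        using topological_basisE[OF B(2) Q(1) z(2)] by blast
      obtain m where "inverse (real (Suc m)) < r" using reals_Archimedean[OF U(2)] by blast
      then have m: "1 / real (Suc m) \<le> r" by (simp add: divide_inverse)
      have "inner_ball_at K (1 / real (Suc m)) y" if "y \<in> frontier K \<inter> b" for y
        using inner_ball_at_mono[OF Q(3) _ m] that b(3) by auto
      then have "K \<in> T b m" using reg z(1) b(2) by (auto simp: T_def)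
      then show "K \<in> \<Union>F" using K b(1) by (auto simp: F_def)
    qed
  qed (auto simp: F_def)
  ultimately show ?thesis
    unfolding generic_C1_regular_convex_body_def meagre_in_def N_def[symmetric] by blast
qed

end
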